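(* Let $k$ and $n$ be positive integers. Then: (1) In the ring $\mathbb{Z}$, $$\gcd\{\,s_\lambda(\underbrace{1,\dots,1}_{k}) : \lambda\vdash n\,\}=\frac{k}{\gcd(n,k)}.$$ (2) In the polynomial ring $\mathbb{Q}[q]$, $$\gcd\{\,s_\lambda(1,q,\dots,q^{k-1}) : \lambda\vdash n\,\}=\frac{[k]_q}{[\gcd(n,k)]_q},$$ where the greatest common divisor is taken to be a monic polynomial.
   Context: Here $\lambda\vdash n$ means that $\lambda$ is a partition of $n$, $s_\lambda$ is the Schur function associated with $\lambda$, and $s_\lambda(y_1,\dots,y_k)$ denotes its specialization $x_i=y_i$ for $1\le i\le k$ and $x_i=0$ for $i>k$. For an integer $a$, $[a]_q=(1-q^a)/(1-q)$. The greatest common divisor in $\mathbb{Z}$ is taken positive. *)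

theory Defs
  imports
    "HOL-Library.FuncSet"
    "HOL-Library.Multiset"
    "HOL-Computational_Algebra.Computational_Algebra"
    "HOL-Computational_Algebra.Field_as_Ring"
begin

definition partitions_of :: "nat \<Rightarrow> nat list set" where
  "partitions_of n = {l. sorted_wrt (\<ge>) l \<and> 0 \<notin> set l \<and> sum_list l = n}"

text \<open>Cells are 0-based (row, column) pairs, in English notation.\<close>

definition young_diagram :: "nat list \<Rightarrow> (nat \<times> nat) set" where
  "young_diagram l = {(i, j). i < length l \<and> j < l ! i}"

text \<open>Entries are positive integers; tableaux are extensional (\<^const>\<open>undefined\<close> off the
  diagram), so that distinct functions are distinct tableaux.\<close>

definition ssyt :: "nat list \<Rightarrow> (nat \<times> nat \<Rightarrow> nat) set" where
  "ssyt l = {T \<in> young_diagram l \<rightarrow>\<^sub>E {1..}.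
     (\<forall>i j. (i, j) \<in> young_diagram l \<and> (i, Suc j) \<in> young_diagram l
        \<longrightarrow> T (i, j) \<le> T (i, Suc j)) \<and>
     (\<forall>i j. (i, j) \<in> young_diagram l \<and> (Suc i, j) \<in> young_diagram l
        \<longrightarrow> T (i, j) < T (Suc i, j))}"

text \<open>
  A formal power series with integer coefficients in the variables \<open>x\<^sub>1, x\<^sub>2, \<dots>\<close> is given by its
  coefficient function. A monomial is encoded as the multiset of the indices of its variables, so
  \<open>x\<^sub>1\<^sup>2 x\<^sub>3\<close> is \<open>{#1, 1, 3#}\<close>. The Schur function is the generating function of the semistandard
  tableaux \<open>T\<close>, each of which contributes the monomial consisting of the factors
  \<open>x\<^bsub>T c\<^esub>\<close> for all cells \<open>c\<close>.
\<close>

definition tableau_monomial :: "nat list \<Rightarrow> (nat \<times> nat \<Rightarrow> nat) \<Rightarrow> nat multiset" where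
  "tableau_monomial l T = image_mset T (mset_set (young_diagram l))"

definition schur :: "nat list \<Rightarrow> nat multiset \<Rightarrow> int" where
  "schur l m = int (card {T \<in> ssyt l. tableau_monomial l T = m})"

text \<open>
  Substitution of \<open>y i\<close> for \<open>x\<^sub>i\<close> if \<open>1 \<le> i \<le> k\<close>, and of \<open>0\<close> for the other variables: just the monomials
  in \<open>x\<^sub>1, \<dots>, x\<^sub>k\<close> survive. This is meaningful for series with only finitely many such monomials;
  see \<open>finite_schur_support\<close> below for Schur functions.
\<close>

definition specialize ::
  "(nat multiset \<Rightarrow> int) \<Rightarrow> nat \<Rightarrow> (nat \<Rightarrow> 'a) \<Rightarrow> 'a :: comm_ring_1" where
  "specialize f k y =
     (\<Sum>m | f m \<noteq> 0 \<and> set_mset m \<subseteq> {1..k}. of_int (f m) * (\<Prod>i\<in>#m. y i))"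

text \<open>The division is exact by \<open>q_int_mult\<close> below.\<close>

definition q_int :: "nat \<Rightarrow> rat poly" where
  "q_int a = (1 - [:0, 1:] ^ a) div (1 - [:0, 1:])"

lemma q_int_mult: "q_int a * (1 - [:0, 1:]) = 1 - [:0, 1:] ^ a"
proof -
  have "1 - [:0, 1:] dvd 1 - [:0, 1 :: rat:] ^ a"
    by (metis dvd_triv_left one_diff_power_eq)
  then show ?thesis
    by (simp add: q_int_def)
qed

lemma q_int_dvd:
  assumes "d dvd k"
  shows "q_int d dvd q_int k"
proof -
  obtain c where k: "k = d * c" using assms by blast
  have "1 - [:0, 1:] ^ d dvd 1 - ([:0, 1 :: rat:] ^ d) ^ c"
    by (metis dvd_triv_left one_diff_power_eq)
  then have "q_int d * (1 - [:0, 1:]) dvd q_int k * (1 - [:0, 1:])"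
    by (simp only: q_int_mult k power_mult)
  moreover have "1 - [:0, 1 :: rat:] \<noteq> 0"
    by (simp add: one_pCons)
  ultimately show ?thesis
    by (simp only: dvd_mult_cancel_right) simp
qed

lemma finite_young_diagram: "finite (young_diagram l)"
proof -
  have "young_diagram l = (SIGMA i:{..<length l}. {..<l ! i})"
    by (auto simp: young_diagram_def)
  then show ?thesis by simp
qed

lemma set_tableau_monomial: "set_mset (tableau_monomial l T) = T ` young_diagram l"
  by (simp add: tableau_monomial_def finite_young_diagram)

lemma finite_ssyt_bounded: "finite {T \<in> ssyt l. T ` young_diagram l \<subseteq> {1..k}}"
proof (rule finite_subset)
  show "{T \<in> ssyt l. T ` young_diagram l \<subseteq> {1..k}} \<subseteq> young_diagram l \<rightarrow>\<^sub>E {1..k}"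
    by (auto simp: ssyt_def PiE_def)
  show "finite (young_diagram l \<rightarrow>\<^sub>E {1..k})"
    by (intro finite_PiE finite_young_diagram) auto
qed

lemma schur_support:
  "{m. schur l m \<noteq> 0 \<and> set_mset m \<subseteq> {1..k}} =
     tableau_monomial l ` {T \<in> ssyt l. T ` young_diagram l \<subseteq> {1..k}}" (is "?M = ?f ` ?S")
proof (intro equalityI subsetI)
  fix m assume m: "m \<in> ?M"
  then have "{T \<in> ssyt l. tableau_monomial l T = m} \<noteq> {}"
    by (auto simp: schur_def simp del: Collect_empty_eq)
  with m show "m \<in> ?f ` ?S"
    using set_tableau_monomial by fastforce
next
  fix m assume "m \<in> ?f ` ?S"
  then obtain T where T: "T \<in> ?S" "m = tableau_monomial l T" by blast
  then have sub: "set_mset m \<subseteq> {1..k}" by (simp add: set_tableau_monomial)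
  have "{T \<in> ssyt l. tableau_monomial l T = m} \<subseteq> ?S"
    using sub set_tableau_monomial by blast
  then have "finite {T \<in> ssyt l. tableau_monomial l T = m}"
    using finite_ssyt_bounded finite_subset by blast
  then show "m \<in> ?M"
    using T sub by (auto simp: schur_def card_eq_0_iff)
qed

lemma finite_schur_support: "finite {m. schur l m \<noteq> 0 \<and> set_mset m \<subseteq> {1..k}}"
  unfolding schur_support using finite_ssyt_bounded by (rule finite_imageI)

lemma specialize_schur:
  "specialize (schur l) k y =
     (\<Sum>T | T \<in> ssyt l \<and> T ` young_diagram l \<subseteq> {1..k}. \<Prod>c\<in>young_diagram l. y (T c))"
proof -
  let ?S = "{T \<in> ssyt l. T ` young_diagram l \<subseteq> {1..k}}"
  have mono: "(\<Prod>i\<in>#tableau_monomial l T. y i) = (\<Prod>c\<in>young_diagram l. y (T c))" for T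
    by (simp add: tableau_monomial_def prod_unfold_prod_mset image_mset.compositionality o_def)
  have "specialize (schur l) k y =
      (\<Sum>m\<in>tableau_monomial l ` ?S. of_int (schur l m) * (\<Prod>i\<in>#m. y i))"
    by (simp only: specialize_def schur_support)
  also have "\<dots> = (\<Sum>m\<in>tableau_monomial l ` ?S. \<Sum>T | T \<in> ?S \<and> tableau_monomial l T = m.
      \<Prod>c\<in>young_diagram l. y (T c))"
  proof (rule sum.cong[OF refl])
    fix m assume "m \<in> tableau_monomial l ` ?S"
    then have "set_mset m \<subseteq> {1..k}" by (auto simp: set_tableau_monomial)
    then have eq: "{T. T \<in> ?S \<and> tableau_monomial l T = m} = {T \<in> ssyt l. tableau_monomial l T = m}"
      using set_tableau_monomial by blast
    have "(\<Sum>T | T \<in> ssyt l \<and> tableau_monomial l T = m. \<Prod>c\<in>young_diagram l. y (T c)) =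
        (\<Sum>T | T \<in> ssyt l \<and> tableau_monomial l T = m. \<Prod>i\<in>#m. y i)"
      by (rule sum.cong[OF refl]) (auto simp: mono)
    then show "of_int (schur l m) * (\<Prod>i\<in>#m. y i) = (\<Sum>T | T \<in> ?S \<and> tableau_monomial l T = m.
        \<Prod>c\<in>young_diagram l. y (T c))"
      unfolding eq by (simp add: schur_def)
  qed
  also have "\<dots> = (\<Sum>T\<in>?S. \<Prod>c\<in>young_diagram l. y (T c))"
    by (rule sum.image_gen[symmetric]) (rule finite_ssyt_bounded)
  finally show ?thesis .
qed

end

theory Submission
  imports Defs "HOL-Combinatorics.Transposition"
begin

text \<open>
  Write \<open>g = gcd n k\<close>, and let \<open>S\<close> be a homogeneous symmetric polynomial of degree \<open>n\<close> with integer
  coefficients, evaluated at \<open>1, q, \<dots>, q ^ (k - 1)\<close>. Modulo \<open>1 - q ^ k\<close>, multiplication by \<open>q\<close> permutes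
  these points cyclically, so \<open>S = q ^ n * S\<close>: the product \<open>(1 - q ^ n) * S\<close> is divisible by
  \<open>1 - q ^ k\<close>, and then so is \<open>(1 - q ^ g) * S\<close>. Over \<open>\<rat>[q]\<close> this says that \<open>S\<close> is divisible by
  \<open>q_int k div q_int g\<close>; over \<open>\<int>[q]\<close>, dividing by \<open>1 - q\<close> and setting \<open>q = 1\<close>, it says that \<open>k div g\<close>
  divides the value of \<open>S\<close> at \<open>q = 1\<close>. For Schur functions this yields one half of both claims
  (\<open>one_minus_power_dvd_specialize\<close> and its two consequences). The symmetry of Schur
  functions (\<open>schur_swap\<close>) comes from the Bender--Knuth involution, which is just a
  reflection of intervals when tableaux are read as Gelfand--Tsetlin patterns.

  Conversely, the Schur functions of degree \<open>n\<close> span all symmetric forms of degree \<open>n\<close> over the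
  integers, so a common divisor \<open>D\<close> of their values divides the value of every symmetric form
  (\<open>dvd_specialize_symmetric_form\<close>), and forms with simple values can be used to bound \<open>D\<close>.

  Over \<open>\<rat>[q]\<close>, two forms suffice. The power sum of degree \<open>n\<close> takes the value
  \<open>(1 - q ^ (n * k)) / (1 - q ^ n)\<close>, which makes \<open>D\<close> squarefree and coprime to \<open>1 - q ^ n\<close>. The
  \<open>n\<close>-th power of the sum of the variables takes the value \<open>q_int k ^ n\<close>, so a squarefree \<open>D\<close> divides
  \<open>q_int k\<close>, and being coprime to \<open>q_int g\<close> it divides the quotient (\<open>dvd_q_int_div\<close>).

  Over \<open>\<int>\<close>, the monomial symmetric function of the partition of \<open>n\<close> into \<open>d\<close> equal parts takes the
  value \<open>k choose d\<close>. If \<open>d\<close> is the exact power of a prime \<open>p\<close> in \<open>g\<close>, then the exponent of \<open>p\<close> in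
  \<open>k choose d\<close> equals that in \<open>k div g\<close>, which bounds the exponent of \<open>p\<close> in \<open>D\<close> (\<open>dvd_div_gcd\<close>).
\<close>


section \<open>Semistandard tableaux as Gelfand--Tsetlin patterns\<close>

definition row_length :: "nat list \<Rightarrow> nat \<Rightarrow> nat" where
  "row_length l r = (if r < length l then l ! r else 0)"

lemma young_diagram_iff: "(r, j) \<in> young_diagram l \<longleftrightarrow> j < row_length l r"
  by (simp add: young_diagram_def row_length_def)

lemma row_length_antimono:
  assumes "l \<in> partitions_of n" "r \<le> s"
  shows "row_length l s \<le> row_length l r"
  using assms by (auto simp: partitions_of_def row_length_def sorted_wrt_iff_nth_less le_less)

text \<open>
  As the rows of a tableau increase weakly, the entries \<open>\<le> t\<close> of row \<open>r\<close> occupy its first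
  \<open>level l T t r\<close> cells. So these numbers determine the tableau, and for fixed \<open>t\<close> they are the row
  lengths of the shape occupied by the entries \<open>\<le> t\<close>.
\<close>

definition level :: "nat list \<Rightarrow> (nat \<times> nat \<Rightarrow> nat) \<Rightarrow> nat \<Rightarrow> nat \<Rightarrow> nat" where
  "level l T t r = card {j. j < row_length l r \<and> T (r, j) \<le> t}"

text \<open>
  The Gelfand--Tsetlin patterns with top row \<open>l\<close>: chains of shapes, indexed by \<open>t\<close>, from the
  empty shape to \<open>l\<close>, in which consecutive shapes interlace (they differ by a horizontal strip).
  The chain is constant from \<open>k\<close> on, rather than cut off at \<open>k\<close>, so that \<^const>\<open>level\<close> is a
  pattern on the nose.
\<close>

definition gt_pattern :: "nat list \<Rightarrow> nat \<Rightarrow> (nat \<Rightarrow> nat \<Rightarrow> nat) \<Rightarrow> bool" where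
  "gt_pattern l k a \<longleftrightarrow> (\<forall>r. a 0 r = 0) \<and> (\<forall>t\<ge>k. \<forall>r. a t r = row_length l r) \<and>
     (\<forall>t r. a t r \<le> a (Suc t) r \<and> a (Suc t) (Suc r) \<le> a t r)"

definition tableau_of :: "nat list \<Rightarrow> (nat \<Rightarrow> nat \<Rightarrow> nat) \<Rightarrow> nat \<times> nat \<Rightarrow> nat" where
  "tableau_of l a = (\<lambda>(r, j)\<in>young_diagram l. LEAST t. j < a t r)"

lemma ssyt_row_mono:
  assumes "T \<in> ssyt l" "j \<le> j'" "j' < row_length l r"
  shows "T (r, j) \<le> T (r, j')"
  using assms(2,3)
proof (induction j' rule: dec_induct)
  case (step i)
  then have "T (r, i) \<le> T (r, Suc i)"
    using assms(1) by (auto simp: ssyt_def young_diagram_iff)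
  with step show ?case by simp
qed simp

lemma ssyt_column_step:
  assumes "l \<in> partitions_of n" "T \<in> ssyt l" "j < row_length l (Suc r)"
  shows "j < row_length l r" "T (r, j) < T (Suc r, j)"
proof -
  show "j < row_length l r"
    using row_length_antimono[OF assms(1), of r "Suc r"] assms(3) by simp
  with assms(2,3) show "T (r, j) < T (Suc r, j)"
    by (auto simp: ssyt_def young_diagram_iff)
qed

lemma downward_closed_eq_lessThan:
  assumes "finite S" "\<And>i j. i < j \<Longrightarrow> j \<in> S \<Longrightarrow> i \<in> S"
  shows "S = {..<card S :: nat}"
proof (cases "S = {}")
  case False
  have "S = {..Max S}"
    using Max_in[OF assms(1) False] Max_ge[OF assms(1)] assms(2) by (fastforce simp: le_less)
  then show ?thesis
    by (metis card_atMost lessThan_Suc_atMost)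
qed simp

lemma le_iff_less_level:
  assumes "T \<in> ssyt l" "j < row_length l r"
  shows "T (r, j) \<le> t \<longleftrightarrow> j < level l T t r"
proof -
  let ?S = "{j. j < row_length l r \<and> T (r, j) \<le> t}"
  have "?S = {..<card ?S}"
  proof (rule downward_closed_eq_lessThan)
    show "i \<in> ?S" if "i < j" "j \<in> ?S" for i j
      using that ssyt_row_mono[OF assms(1), of i j r] by auto
  qed simp
  then show ?thesis
    unfolding level_def using assms(2) by blast
qed

lemma gt_pattern_mono: "gt_pattern l k a \<Longrightarrow> t \<le> t' \<Longrightarrow> a t r \<le> a t' r"
  by (rule lift_Suc_mono_le[of "\<lambda>t. a t r"]) (auto simp: gt_pattern_def)

lemma gt_pattern_le_row_length: "gt_pattern l k a \<Longrightarrow> a t r \<le> row_length l r"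
  using gt_pattern_mono[of l k a t "max t k" r] by (simp add: gt_pattern_def)

lemma tableau_of_le_iff:
  assumes "gt_pattern l k a" "j < row_length l r"
  shows "tableau_of l a (r, j) \<le> t \<longleftrightarrow> j < a t r"
proof -
  have "j < a k r" using assms by (simp add: gt_pattern_def)
  then have "j < a (LEAST t. j < a t r) r" by (rule LeastI)
  moreover have "tableau_of l a (r, j) = (LEAST t. j < a t r)"
    using assms(2) by (simp add: tableau_of_def young_diagram_iff)
  ultimately show ?thesis
    using gt_pattern_mono[OF assms(1)] Least_le[of "\<lambda>t. j < a t r" t] by (metis order_less_le_trans)
qed

lemma gt_pattern_level:
  assumes "l \<in> partitions_of n" "T \<in> ssyt l" "T ` young_diagram l \<subseteq> {1..k}"
  shows "gt_pattern l k (level l T)"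
proof -
  have T: "1 \<le> T (r, j) \<and> T (r, j) \<le> k" if "j < row_length l r" for r j
    using assms(3) that young_diagram_iff by fastforce
  have "level l T 0 r = 0" for r
    using T by (fastforce simp: level_def)
  moreover have "level l T t r = row_length l r" if "t \<ge> k" for t r
  proof -
    have "{j. j < row_length l r \<and> T (r, j) \<le> t} = {..<row_length l r}"
      using T that by fastforce
    then show ?thesis by (simp add: level_def)
  qed
  moreover have "level l T t r \<le> level l T (Suc t) r" for t r
    unfolding level_def by (rule card_mono) auto
  moreover have "level l T (Suc t) (Suc r) \<le> level l T t r" for t r
    unfolding level_def using ssyt_column_step[OF assms(1,2)] by (intro card_mono) fastforce+
  ultimately show ?thesis by (simp add: gt_pattern_def)
qed

lemma tableau_of_ssyt:
  assumes "l \<in> partitions_of n" "gt_pattern l k a"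
  shows "tableau_of l a \<in> ssyt l" "tableau_of l a ` young_diagram l \<subseteq> {1..k}"
proof -
  note le = tableau_of_le_iff[OF assms(2)]
  have pos: "1 \<le> tableau_of l a (r, j)" if "j < row_length l r" for r j
    using le[OF that, of 0] assms(2) by (auto simp: gt_pattern_def)
  have "tableau_of l a (r, j) \<le> k" if "j < row_length l r" for r j
    using le[OF that, of k] assms(2) that by (auto simp: gt_pattern_def)
  with pos show "tableau_of l a ` young_diagram l \<subseteq> {1..k}"
    by (auto simp: young_diagram_iff)
  have row: "tableau_of l a (r, j) \<le> tableau_of l a (r, Suc j)" if "Suc j < row_length l r" for r j
    using le[of j r] le[of "Suc j" r] that by (meson Suc_lessD order_refl)
  have col: "tableau_of l a (r, j) < tableau_of l a (Suc r, j)"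
    if below: "j < row_length l r" "j < row_length l (Suc r)" for r j
  proof -
    obtain t where t: "tableau_of l a (Suc r, j) = Suc t"
      using pos[OF below(2)] by (cases "tableau_of l a (Suc r, j)") auto
    then have "j < a (Suc t) (Suc r)" using le[OF below(2)] by (metis order_refl)
    also have "\<dots> \<le> a t r" using assms(2) by (simp add: gt_pattern_def)
    finally show ?thesis using le[OF below(1), of t] t by simp
  qed
  have ext: "tableau_of l a \<in> extensional (young_diagram l)"
    by (simp add: tableau_of_def)
  show "tableau_of l a \<in> ssyt l"
    unfolding ssyt_def using row col pos ext by (auto simp: young_diagram_iff PiE_def)
qed

text \<open>
  Strict increase down the columns says exactly that an entry \<open>\<le> t + 1\<close> in row \<open>r + 1\<close> lies below an
  entry \<open>\<le> t\<close>, which is the second interlacing inequality. The inverse map puts into each cell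
  the first \<open>t\<close> whose shape contains it.
\<close>

lemma bij_betw_level:
  assumes "l \<in> partitions_of n"
  shows "bij_betw (level l) {T \<in> ssyt l. T ` young_diagram l \<subseteq> {1..k}} {a. gt_pattern l k a}"
proof (rule bij_betw_byWitness[where f' = "tableau_of l"])
  show "\<forall>T\<in>{T \<in> ssyt l. T ` young_diagram l \<subseteq> {1..k}}. tableau_of l (level l T) = T"
  proof
    fix T assume "T \<in> {T \<in> ssyt l. T ` young_diagram l \<subseteq> {1..k}}"
    then have T: "T \<in> ssyt l" by simp
    show "tableau_of l (level l T) = T"
    proof
      fix c :: "nat \<times> nat"
      obtain r j where c: "c = (r, j)" by fastforce
      show "tableau_of l (level l T) c = T c"
      proof (cases "j < row_length l r")
        case True
        have "(LEAST t. j < level l T t r) = T (r, j)"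
          using le_iff_less_level[OF T True] by (intro Least_equality) auto
        with True show ?thesis by (simp add: c tableau_of_def young_diagram_iff)
      next
        case False
        then have "c \<notin> young_diagram l" by (simp add: c young_diagram_iff)
        then show ?thesis using T by (auto simp: c tableau_of_def ssyt_def PiE_def extensional_def)
      qed
    qed
  qed
  show "\<forall>a\<in>{a. gt_pattern l k a}. level l (tableau_of l a) = a"
  proof (intro ballI ext)
    fix a t r assume "a \<in> {a. gt_pattern l k a}"
    then have a: "gt_pattern l k a" by simp
    have "{j. j < row_length l r \<and> tableau_of l a (r, j) \<le> t} = {..<a t r}"
      using tableau_of_le_iff[OF a, of _ r t] gt_pattern_le_row_length[OF a, of t r] by auto
    then show "level l (tableau_of l a) t r = a t r" by (simp add: level_def)
  qed
  show "level l ` {T \<in> ssyt l. T ` young_diagram l \<subseteq> {1..k}} \<subseteq> {a. gt_pattern l k a}"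
    using gt_pattern_level[OF assms] by blast
  show "tableau_of l ` {a. gt_pattern l k a} \<subseteq> {T \<in> ssyt l. T ` young_diagram l \<subseteq> {1..k}}"
    using tableau_of_ssyt[OF assms] by blast
qed

lemma size_filter_tableau_monomial:
  "size {#x \<in># tableau_monomial l T. x \<le> t#} = (\<Sum>r<length l. level l T t r)"
proof -
  have "size {#x \<in># tableau_monomial l T. x \<le> t#} = card {c \<in> young_diagram l. T c \<le> t}"
    by (simp add: tableau_monomial_def filter_mset_image_mset finite_young_diagram)
  also have "{c \<in> young_diagram l. T c \<le> t} =
      (SIGMA r:{..<length l}. {j. j < row_length l r \<and> T (r, j) \<le> t})"
    by (auto simp: young_diagram_def row_length_def)
  also have "card \<dots> = (\<Sum>r<length l. level l T t r)"
    by (simp add: level_def)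
  finally show ?thesis .
qed

text \<open>
  The sum of level \<open>t\<close> of a tableau is the number of its entries \<open>\<le> t\<close>. As these numbers determine
  the content, prescribing the content amounts to linear conditions on the pattern.
\<close>

lemma multiset_eq_iff_size_filter_le:
  fixes m m' :: "nat multiset"
  shows "m = m' \<longleftrightarrow> (\<forall>t. size {#x \<in># m. x \<le> t#} = size {#x \<in># m'. x \<le> t#})"
proof
  assume eq: "\<forall>t. size {#x \<in># m. x \<le> t#} = size {#x \<in># m'. x \<le> t#}"
  have split: "size {#x \<in># M. x \<le> t#} = count M t + size {#x \<in># M. x < t#}" for M :: "nat multiset" and t
  proof -
    have "{#x \<in># M. x \<le> t#} = {#x \<in># M. x = t#} + {#x \<in># M. x < t#}"
      by (rule multiset_eqI) auto
    then show ?thesis by (simp add: count_conv_size_mset)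
  qed
  have "size {#x \<in># m. x < t#} = size {#x \<in># m'. x < t#}" for t
  proof (cases t)
    case (Suc s)
    then show ?thesis using eq[rule_format, of s] by (simp add: less_Suc_eq_le)
  qed simp
  then show "m = m'"
    using eq split by (metis add_right_cancel multiset_eqI)
qed simp

definition gt_content :: "nat list \<Rightarrow> nat multiset \<Rightarrow> (nat \<Rightarrow> nat \<Rightarrow> nat) \<Rightarrow> bool" where
  "gt_content l m a \<longleftrightarrow> (\<forall>t. (\<Sum>r<length l. a t r) = size {#x \<in># m. x \<le> t#})"

text \<open>
  The coefficients of a Schur function as numbers of patterns with prescribed level sums. In this
  form their symmetry becomes visible, because the entries of one level can be varied independently
  of each other.
\<close>

lemma schur_eq_card_gt_pattern:
  assumes "l \<in> partitions_of n" "set_mset m \<subseteq> {1..k}"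
  shows "schur l m = int (card {a. gt_pattern l k a \<and> gt_content l m a})"
proof -
  have content: "tableau_monomial l T = m \<longleftrightarrow> gt_content l m (level l T)" for T
    by (simp add: multiset_eq_iff_size_filter_le[of _ m] size_filter_tableau_monomial gt_content_def)
  note bij = bij_betw_level[OF assms(1), of k]
  have "bij_betw (level l) {T \<in> ssyt l. tableau_monomial l T = m}
      {a. gt_pattern l k a \<and> gt_content l m a}"
  proof (rule bij_betw_subset[OF bij])
    show sub: "{T \<in> ssyt l. tableau_monomial l T = m} \<subseteq> {T \<in> ssyt l. T ` young_diagram l \<subseteq> {1..k}}"
      using assms(2) set_tableau_monomial by blast
    have "level l ` {T \<in> ssyt l. tableau_monomial l T = m} =
        {a \<in> level l ` {T \<in> ssyt l. T ` young_diagram l \<subseteq> {1..k}}. gt_content l m a}"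
      using sub content by blast
    then show "level l ` {T \<in> ssyt l. tableau_monomial l T = m} = {a. gt_pattern l k a \<and> gt_content l m a}"
      unfolding bij_betw_imp_surj_on[OF bij] by simp
  qed
  then show ?thesis
    by (simp add: schur_def bij_betw_same_card)
qed

section \<open>The symmetry of Schur functions\<close>

abbreviation swap :: "nat \<Rightarrow> nat \<Rightarrow> nat" where
  "swap i \<equiv> transpose (Suc i) (Suc (Suc i))"

text \<open>
  If all levels except level \<open>i + 1\<close> are fixed, then the interlacing conditions confine each entry
  of this level to an interval of its own, with the endpoints \<open>gt_lower\<close> and \<open>gt_upper\<close>.
\<close>

definition gt_lower :: "nat \<Rightarrow> (nat \<Rightarrow> nat \<Rightarrow> nat) \<Rightarrow> nat \<Rightarrow> nat" where
  "gt_lower i a r = max (a (Suc (Suc i)) (Suc r)) (a i r)"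

definition gt_upper :: "nat \<Rightarrow> (nat \<Rightarrow> nat \<Rightarrow> nat) \<Rightarrow> nat \<Rightarrow> nat" where
  "gt_upper i a r =
     (case r of 0 \<Rightarrow> a (Suc (Suc i)) 0 | Suc s \<Rightarrow> min (a (Suc (Suc i)) (Suc s)) (a i s))"

text \<open>
  The reflection of every entry of level \<open>i + 1\<close> in the midpoint of its interval. On tableaux, this
  is the Bender--Knuth involution.
\<close>

definition gt_toggle :: "nat \<Rightarrow> (nat \<Rightarrow> nat \<Rightarrow> nat) \<Rightarrow> nat \<Rightarrow> nat \<Rightarrow> nat" where
  "gt_toggle i a = a(Suc i := (\<lambda>r. gt_lower i a r + gt_upper i a r - a (Suc i) r))"

lemma gt_pattern_bounds:
  assumes "gt_pattern l k a"
  shows "gt_lower i a r \<le> a (Suc i) r" "a (Suc i) r \<le> gt_upper i a r"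
  using assms by (auto simp: gt_pattern_def gt_lower_def gt_upper_def split: nat.split)

text \<open>
  The sum telescopes since \<open>max x y + min x y = x + y\<close>, applied to the upper endpoint in
  one row and the lower endpoint in the row above. Hence the toggle replaces the sum of level
  \<open>i + 1\<close> by what is left of the sums of its two neighbours.
\<close>

lemma sum_gt_bounds:
  "(\<Sum>r<L. gt_lower i a r + gt_upper i a r) + gt_upper i a L =
     (\<Sum>r<L. a i r + a (Suc (Suc i)) r) + a (Suc (Suc i)) L"
proof (induction L)
  case (Suc L)
  have "gt_lower i a L + gt_upper i a (Suc L) = a i L + a (Suc (Suc i)) (Suc L)"
    by (simp add: gt_lower_def gt_upper_def)
  with Suc show ?case by simp
qed (simp add: gt_upper_def)

lemma gt_toggle_involution:
  assumes "gt_pattern l k a"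
  shows "gt_toggle i (gt_toggle i a) = a"
proof -
  have "gt_lower i (gt_toggle i a) = gt_lower i a" "gt_upper i (gt_toggle i a) = gt_upper i a"
    by (auto simp: gt_lower_def gt_upper_def gt_toggle_def fun_eq_iff split: nat.split)
  then show ?thesis
    using gt_pattern_bounds[OF assms, of i]
    by (simp add: gt_toggle_def fun_eq_iff diff_diff_cancel trans_le_add2)
qed

lemma gt_pattern_toggle:
  assumes a: "gt_pattern l k a" and i: "Suc i < k"
  shows "gt_pattern l k (gt_toggle i a)"
proof -
  let ?b = "gt_toggle i a"
  have other: "?b t = a t" if "t \<noteq> Suc i" for t
    using that by (simp add: gt_toggle_def)
  have b: "gt_lower i a r \<le> ?b (Suc i) r" "?b (Suc i) r \<le> gt_upper i a r" for r
    using gt_pattern_bounds[OF a, of i r] by (auto simp: gt_toggle_def)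
  have up: "gt_upper i a r \<le> a (Suc (Suc i)) r" "gt_upper i a (Suc r) \<le> a i r" for r
    by (auto simp: gt_upper_def split: nat.split)
  have low: "a (Suc (Suc i)) (Suc r) \<le> gt_lower i a r" "a i r \<le> gt_lower i a r" for r
    by (auto simp: gt_lower_def)
  have a_step: "a t r \<le> a (Suc t) r" "a (Suc t) (Suc r) \<le> a t r" for t r
    using a by (auto simp: gt_pattern_def)
  have "?b t r \<le> ?b (Suc t) r \<and> ?b (Suc t) (Suc r) \<le> ?b t r" for t r
  proof -
    consider "t = Suc i" | "t = i" | "t \<noteq> Suc i" "Suc t \<noteq> Suc i" by blast
    then show ?thesis
    proof cases
      case 1
      then show ?thesis
        using b[of r] up(1)[of r] low(1)[of r] other[of "Suc (Suc i)"]
        by (auto intro: order_trans)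
    next
      case 2
      then show ?thesis
        using b(1)[of r] b(2)[of "Suc r"] up(2)[of r] low(2)[of r] other[of i]
        by (auto intro: order_trans)
    next
      case 3
      then show ?thesis using other a_step by auto
    qed
  qed
  moreover have "?b 0 r = 0" for r
    using a other[of 0] by (simp add: gt_pattern_def)
  moreover have "?b t r = row_length l r" if "t \<ge> k" for t r
    using a other[of t] that i by (simp add: gt_pattern_def)
  ultimately show ?thesis by (simp add: gt_pattern_def)
qed

lemma size_filter_swap:
  fixes m :: "nat multiset"
  shows "size {#x \<in># image_mset (swap i) m. x \<le> t#} =
    (if t = Suc i
     then size {#x \<in># m. x \<le> i#} + size {#x \<in># m. x \<le> Suc (Suc i)#} - size {#x \<in># m. x \<le> Suc i#}
     else size {#x \<in># m. x \<le> t#})"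
proof -
  have "size {#x \<in># image_mset (swap i) m. x \<le> Suc i#} + size {#x \<in># m. x \<le> Suc i#} =
      size {#x \<in># m. x \<le> i#} + size {#x \<in># m. x \<le> Suc (Suc i)#}"
    by (induction m) (auto simp: transpose_def)
  moreover have "size {#x \<in># image_mset (swap i) m. x \<le> t#} = size {#x \<in># m. x \<le> t#}"
    if "t \<noteq> Suc i"
    using that by (induction m) (auto simp: transpose_def)
  ultimately show ?thesis by auto
qed

lemma gt_content_toggle:
  assumes a: "gt_pattern l k a" and m: "gt_content l m a"
  shows "gt_content l (image_mset (swap i) m) (gt_toggle i a)"
proof -
  let ?L = "length l"
  \<comment> \<open>Truncated subtraction is harmless here, as no entry exceeds the sum of its bounds.\<close>
  have "(\<Sum>r<?L. gt_toggle i a (Suc i) r) =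
      (\<Sum>r<?L. gt_lower i a r + gt_upper i a r) - (\<Sum>r<?L. a (Suc i) r)"
    unfolding gt_toggle_def fun_upd_same
    using gt_pattern_bounds[OF a, of i] by (intro sum_subtractf_nat) (auto intro: trans_le_add2)
  moreover have "a (Suc (Suc i)) ?L = 0"
    using gt_pattern_le_row_length[OF a, of "Suc (Suc i)" ?L] by (simp add: row_length_def)
  moreover from this have "gt_upper i a ?L = 0"
    by (auto simp: gt_upper_def split: nat.split)
  ultimately have "(\<Sum>r<?L. gt_toggle i a (Suc i) r) =
      (\<Sum>r<?L. a i r) + (\<Sum>r<?L. a (Suc (Suc i)) r) - (\<Sum>r<?L. a (Suc i) r)"
    using sum_gt_bounds[of i a ?L] by (simp add: sum.distrib)
  then show ?thesis
    using m by (auto simp: gt_content_def size_filter_swap gt_toggle_def)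
qed

lemma swap_subset:
  assumes "set_mset m \<subseteq> {1..k}" "Suc i < k"
  shows "set_mset (image_mset (swap i) m) \<subseteq> {1..k}"
  using assms by (auto simp: transpose_def)

lemma image_mset_swap_swap [simp]: "image_mset (swap i) (image_mset (swap i) m) = m"
  by (simp add: image_mset.compositionality)

text \<open>
  The toggle exchanges the numbers of entries \<open>i + 1\<close> and \<open>i + 2\<close>, hence it matches the tableaux
  that are counted on the two sides.
\<close>

lemma schur_swap:
  assumes l: "l \<in> partitions_of n" and m: "set_mset m \<subseteq> {1..k}" and i: "Suc i < k"
  shows "schur l (image_mset (swap i) m) = schur l m"
proof -
  let ?A = "\<lambda>m. {a. gt_pattern l k a \<and> gt_content l m a}"
  have "bij_betw (gt_toggle i) (?A m) (?A (image_mset (swap i) m))"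
  proof (rule bij_betw_byWitness[where f' = "gt_toggle i"])
    show "gt_toggle i ` ?A m \<subseteq> ?A (image_mset (swap i) m)"
      using gt_pattern_toggle[OF _ i] gt_content_toggle by blast
    show "gt_toggle i ` ?A (image_mset (swap i) m) \<subseteq> ?A m"
      using gt_pattern_toggle[OF _ i] gt_content_toggle[of l k _ "image_mset (swap i) m" i] by auto
  qed (use gt_toggle_involution in auto)
  then show ?thesis
    using schur_eq_card_gt_pattern[OF l m] schur_eq_card_gt_pattern[OF l swap_subset[OF m i]]
    by (simp add: bij_betw_same_card)
qed


section \<open>Symmetric forms in finitely many variables\<close>

definition monomials :: "nat \<Rightarrow> nat \<Rightarrow> nat multiset set" where
  "monomials k n = {m. set_mset m \<subseteq> {1..k} \<and> size m = n}"

lemma finite_monomials: "finite (monomials k n)"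
proof (rule finite_subset)
  show "monomials k n \<subseteq> mset ` {xs. set xs \<subseteq> {1..k} \<and> length xs = n}"
  proof
    fix m assume m: "m \<in> monomials k n"
    obtain xs where "mset xs = m" using ex_mset by blast
    with m show "m \<in> mset ` {xs. set xs \<subseteq> {1..k} \<and> length xs = n}"
      by (auto simp: monomials_def)
  qed
  show "finite (mset ` {xs. set xs \<subseteq> {1..k} \<and> length xs = n})"
    by (intro finite_imageI finite_lists_length_eq) simp
qed

text \<open>
  A homogeneous symmetric polynomial of degree \<open>n\<close> in \<open>x\<^sub>1, \<dots>, x\<^sub>k\<close>, given by its coefficients in the
  same way as \<^const>\<open>schur\<close>. Coefficients of monomials in other variables are unconstrained apart
  from the degree, which makes the Schur functions instances for every \<open>k\<close>.
\<close>

definition symmetric_form :: "nat \<Rightarrow> nat \<Rightarrow> (nat multiset \<Rightarrow> int) \<Rightarrow> bool" where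
  "symmetric_form k n f \<longleftrightarrow> (\<forall>m. f m \<noteq> 0 \<longrightarrow> size m = n) \<and>
     (\<forall>m i. set_mset m \<subseteq> {1..k} \<longrightarrow> Suc i < k \<longrightarrow> f (image_mset (swap i) m) = f m)"

lemma symmetric_form_size: "symmetric_form k n f \<Longrightarrow> f m \<noteq> 0 \<Longrightarrow> size m = n"
  unfolding symmetric_form_def by blast

lemma symmetric_form_swap:
  "symmetric_form k n f \<Longrightarrow> set_mset m \<subseteq> {1..k} \<Longrightarrow> Suc i < k \<Longrightarrow> f (image_mset (swap i) m) = f m"
  unfolding symmetric_form_def by simp

lemma specialize_eq_sum:
  assumes "symmetric_form k n f"
  shows "specialize f k y = (\<Sum>m\<in>monomials k n. of_int (f m) * (\<Prod>i\<in>#m. y i))"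
  unfolding specialize_def
proof (rule sum.mono_neutral_left[OF finite_monomials])
  show "{m. f m \<noteq> 0 \<and> set_mset m \<subseteq> {1..k}} \<subseteq> monomials k n"
    using symmetric_form_size[OF assms] by (auto simp: monomials_def)
qed (auto simp: monomials_def)

lemma size_tableau_monomial:
  assumes "l \<in> partitions_of n"
  shows "size (tableau_monomial l T) = n"
proof -
  have "young_diagram l = (SIGMA r:{..<length l}. {..<l ! r})"
    by (auto simp: young_diagram_def)
  then have "card (young_diagram l) = (\<Sum>r<length l. l ! r)" by simp
  also have "\<dots> = n"
    using assms by (simp add: partitions_of_def sum_list_sum_nth atLeast0LessThan)
  finally show ?thesis by (simp add: tableau_monomial_def)
qed

lemma symmetric_form_schur:
  assumes "l \<in> partitions_of n"
  shows "symmetric_form k n (schur l)"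
  unfolding symmetric_form_def
proof (intro conjI allI impI)
  fix m assume "schur l m \<noteq> 0"
  then have "{T \<in> ssyt l. tableau_monomial l T = m} \<noteq> {}"
    by (auto simp: schur_def simp del: Collect_empty_eq)
  then show "size m = n"
    using size_tableau_monomial[OF assms] by blast
qed (rule schur_swap[OF assms])

section \<open>Symmetric forms as integer combinations of Schur functions\<close>

text \<open>
  The content of the tableau that is filled with \<open>r + 1\<close> throughout row \<open>r\<close>; as a monomial, it has
  the parts of \<open>l\<close> as exponents.
\<close>

definition highest_content :: "nat list \<Rightarrow> nat multiset" where
  "highest_content l = tableau_monomial l (\<lambda>(r, j). Suc r)"

lemma ssyt_entry_ge:
  assumes "l \<in> partitions_of n" "T \<in> ssyt l" "j < row_length l r"
  shows "Suc r \<le> T (r, j)"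
  using assms(3)
proof (induction r)
  case 0
  then show ?case using assms(2) by (auto simp: ssyt_def young_diagram_iff PiE_def Pi_def)
next
  case (Suc r)
  then show ?case using ssyt_column_step[OF assms(1,2) Suc.prems] by simp
qed

lemma sum_mset_tableau_monomial:
  "\<Sum>\<^sub># (tableau_monomial l T) = (\<Sum>c\<in>young_diagram l. T c)"
  by (simp add: tableau_monomial_def sum_unfold_sum_mset)

text \<open>
  Entries in row \<open>r\<close> are at least \<open>r + 1\<close>, so the tableau with equality everywhere is the only one
  that minimizes the sum of the entries. This makes the Schur functions unitriangular with respect
  to the sum of the indices of a monomial.
\<close>

lemma ssyt_highest:
  assumes "l \<in> partitions_of n" "T \<in> ssyt l"
    and "\<Sum>\<^sub># (tableau_monomial l T) \<le> \<Sum>\<^sub># (highest_content l)"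
  shows "T = (\<lambda>(r, j)\<in>young_diagram l. Suc r)"
proof -
  let ?H = "\<lambda>(r, j). Suc r"
  have ge: "?H c \<le> T c" if "c \<in> young_diagram l" for c
    using ssyt_entry_ge[OF assms(1,2)] that by (cases c) (auto simp: young_diagram_iff)
  have "T c = ?H c" if c: "c \<in> young_diagram l" for c
  proof (rule ccontr)
    assume "T c \<noteq> ?H c"
    with ge[OF c] have "?H c < T c" by simp
    with c ge have "(\<Sum>c\<in>young_diagram l. ?H c) < (\<Sum>c\<in>young_diagram l. T c)"
      by (intro sum_strict_mono_ex1 finite_young_diagram) auto
    then show False
      using assms(3) by (simp add: highest_content_def sum_mset_tableau_monomial)
  qed
  then show ?thesis
    using assms(2) by (auto simp: ssyt_def PiE_def extensional_def fun_eq_iff)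
qed

lemma tableau_monomial_highest:
  "tableau_monomial l (\<lambda>(r, j)\<in>young_diagram l. Suc r) = highest_content l"
  unfolding tableau_monomial_def highest_content_def
  by (rule image_mset_cong) (auto simp: finite_young_diagram)

lemma schur_highest:
  assumes "l \<in> partitions_of n"
  shows "schur l (highest_content l) = 1"
proof -
  let ?H = "\<lambda>(r, j)\<in>young_diagram l. Suc r"
  have "?H \<in> ssyt l" by (auto simp: ssyt_def)
  moreover have "T = ?H" if "T \<in> ssyt l" "tableau_monomial l T = highest_content l" for T
    using ssyt_highest[OF assms that(1)] that(2) by simp
  ultimately have "{T \<in> ssyt l. tableau_monomial l T = highest_content l} = {?H}"
    using tableau_monomial_highest by blast
  then show ?thesis by (simp add: schur_def)
qed

lemma schur_eq_0:
  assumes "l \<in> partitions_of n" "\<Sum>\<^sub># m \<le> \<Sum>\<^sub># (highest_content l)" "m \<noteq> highest_content l"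
  shows "schur l m = 0"
proof -
  have "T \<notin> ssyt l" if "tableau_monomial l T = m" for T
    using ssyt_highest[OF assms(1), of T] that assms(2,3) tableau_monomial_highest by auto
  then have "{T \<in> ssyt l. tableau_monomial l T = m} = {}" by blast
  then show ?thesis unfolding schur_def by (simp only: card.empty of_nat_0)
qed

lemma count_highest_content:
  "count (highest_content l) x = (case x of 0 \<Rightarrow> 0 | Suc r \<Rightarrow> row_length l r)"
proof -
  have "count (highest_content l) x = card {c \<in> young_diagram l. Suc (fst c) = x}"
    by (simp add: highest_content_def tableau_monomial_def count_conv_size_mset
        filter_mset_image_mset finite_young_diagram case_prod_unfold)
  also have "{c \<in> young_diagram l. Suc (fst c) = x} =
      (case x of 0 \<Rightarrow> {} | Suc r \<Rightarrow> {r} \<times> {..<row_length l r})"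
    by (auto simp: young_diagram_iff split: nat.split)
  finally show ?thesis by (simp split: nat.split add: card_cartesian_product)
qed

lemma ex_partition_highest_content:
  assumes m: "m \<in> monomials k n"
    and dec: "\<And>i. Suc i < k \<Longrightarrow> count m (Suc (Suc i)) \<le> count m (Suc i)"
  shows "\<exists>l\<in>partitions_of n. highest_content l = m"
proof -
  define c where "c i = count m (Suc i)" for i
  have zero: "c i = 0" if "k \<le> i" for i
  proof -
    have "set_mset m \<subseteq> {1..k}" "Suc i \<notin> {1..k}"
      using m that by (auto simp: monomials_def)
    then show ?thesis unfolding c_def by (meson not_in_iff subsetD)
  qed
  have "c (Suc i) \<le> c i" for i
    using dec[of i] zero[of "Suc i"] by (cases "Suc i < k") (auto simp: c_def)
  then have anti: "c j \<le> c i" if "i \<le> j" for i j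
    using that by (rule lift_Suc_antimono_le)
  \<comment> \<open>The number of parts: the decreasing counts vanish from here on.\<close>
  define L where "L = (LEAST i. c i = 0)"
  have "c L = 0" unfolding L_def using zero[OF order_refl] by (rule LeastI)
  then have pos: "c i \<noteq> 0 \<longleftrightarrow> i < L" for i
    using anti[of L i] not_less_Least[of i "\<lambda>i. c i = 0"] by (cases "i < L") (auto simp: L_def)
  define l where "l = map c [0..<L]"
  have row: "row_length l r = c r" for r
    using pos[of r] by (auto simp: row_length_def l_def)
  have "0 \<notin># m" using m by (auto simp: monomials_def)
  then have high: "highest_content l = m"
    by (intro multiset_eqI) (auto simp: count_highest_content row c_def not_in_iff split: nat.split)
  have "sorted_wrt (\<ge>) l"
    using anti by (auto simp: l_def sorted_wrt_iff_nth_less)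
  moreover have "0 \<notin> set l"
  proof
    assume "0 \<in> set l"
    then obtain i where "i < L" "c i = 0" unfolding l_def by auto
    with pos[of i] show False by blast
  qed
  ultimately have "l \<in> partitions_of (sum_list l)" by (simp add: partitions_of_def)
  moreover from this have "sum_list l = n"
    using size_tableau_monomial[of l _ "\<lambda>(r, j). Suc r"] high m
    by (simp add: highest_content_def monomials_def)
  ultimately show ?thesis using high by blast
qed

lemma sum_mset_swap:
  "\<Sum>\<^sub># (image_mset (swap i) m) + count m (Suc (Suc i)) = \<Sum>\<^sub># m + count m (Suc i)"
proof (induction m)
  case (add x m)
  then show ?case
    by (cases "x = Suc i"; cases "x = Suc (Suc i)") simp_all
qed simp

lemma sum_mset_monomials_le:
  assumes "m \<in> monomials k n"
  shows "\<Sum>\<^sub># m \<le> k * n"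
proof -
  have "set_mset m \<subseteq> {1..k} \<Longrightarrow> \<Sum>\<^sub># m \<le> k * size m"
    by (induction m) auto
  then show ?thesis using assms by (auto simp: monomials_def)
qed

text \<open>
  Every symmetric form is an integer combination of Schur functions, stated through the divisibility
  that it entails. Monomials are ordered by the sum of the indices of their variables, a linear
  extension of the dominance order. In a symmetric form \<open>f\<close> the monomials of least index sum \<open>w\<close> have
  weakly decreasing exponents, since exchanging two increasing neighbours would lower the sum. So
  each of them is the \<^const>\<open>highest_content\<close> of a partition, and because the Schur
  functions are unitriangular, subtracting suitable multiples of them removes all monomials
  of index sum \<open>w\<close>. This ends because the index sums are bounded by \<open>k * n\<close>.
\<close>

lemma dvd_specialize_symmetric_form:
  fixes D :: "'a :: comm_ring_1"
  assumes D: "\<And>l. l \<in> partitions_of n \<Longrightarrow> D dvd specialize (schur l) k y"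
    and f: "symmetric_form k n f"
  shows "D dvd specialize f k y"
proof -
  have "D dvd specialize f k y"
    if "symmetric_form k n f" "\<forall>m\<in>monomials k n. f m \<noteq> 0 \<longrightarrow> w \<le> \<Sum>\<^sub># m" for f w
    using that
  proof (induction "Suc (k * n) - w" arbitrary: f w)
    case 0
    have "f m = 0" if "m \<in> monomials k n" for m
      using 0 that sum_mset_monomials_le[OF that] by fastforce
    then show ?case by (simp add: specialize_eq_sum[OF 0(2)])
  next
    case (Suc d)
    note f = Suc.prems(1) and w = Suc.prems(2)
    define A where "A = {m \<in> monomials k n. f m \<noteq> 0 \<and> \<Sum>\<^sub># m = w}"
    have A: "finite A" "A \<subseteq> monomials k n"
      using finite_monomials by (auto simp: A_def)
    have "\<exists>l\<in>partitions_of n. highest_content l = m" if m: "m \<in> A" for m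
    proof (rule ex_partition_highest_content)
      show mm: "m \<in> monomials k n" using m by (simp add: A_def)
      fix i assume i: "Suc i < k"
      let ?m = "image_mset (swap i) m"
      have "f ?m = f m" using symmetric_form_swap[OF f _ i] mm by (auto simp: monomials_def)
      moreover have "?m \<in> monomials k n"
        using mm i swap_subset[of m k i] by (simp add: monomials_def)
      ultimately have "\<Sum>\<^sub># m \<le> \<Sum>\<^sub># ?m" using w m by (auto simp: A_def)
      then show "count m (Suc (Suc i)) \<le> count m (Suc i)"
        using sum_mset_swap[of i m] by linarith
    qed
    then obtain l where l: "\<And>m. m \<in> A \<Longrightarrow> l m \<in> partitions_of n \<and> highest_content (l m) = m"
      by metis
    \<comment> \<open>What remains of \<open>f\<close> after its monomials of index sum \<open>w\<close> have been cleared.\<close>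
    define g where "g x = f x - (\<Sum>m\<in>A. f m * schur (l m) x)" for x
    have schur: "symmetric_form k n (schur (l m))" if "m \<in> A" for m
      using symmetric_form_schur l[OF that] by blast
    have g: "symmetric_form k n g"
      unfolding symmetric_form_def
    proof (intro conjI allI impI)
      fix x assume "g x \<noteq> 0"
      then have "f x \<noteq> 0 \<or> (\<exists>m\<in>A. schur (l m) x \<noteq> 0)"
        unfolding g_def by (metis (no_types, lifting) diff_self mult_zero_right sum.neutral)
      then show "size x = n" using symmetric_form_size[OF f] symmetric_form_size[OF schur] by blast
    next
      fix x :: "nat multiset" and i assume "set_mset x \<subseteq> {1..k}" "Suc i < k"
      then show "g (image_mset (swap i) x) = g x"
        unfolding g_def using symmetric_form_swap[OF f] symmetric_form_swap[OF schur]
        by (metis (no_types, lifting) sum.cong)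
    qed
    have "D dvd specialize g k y"
    proof (rule Suc.hyps(1)[of "Suc w"])
      show "\<forall>x\<in>monomials k n. g x \<noteq> 0 \<longrightarrow> Suc w \<le> \<Sum>\<^sub># x"
      proof (intro ballI impI, rule ccontr)
        fix x assume x: "x \<in> monomials k n" and gx: "g x \<noteq> 0" and "\<not> Suc w \<le> \<Sum>\<^sub># x"
        then have le: "\<Sum>\<^sub># x \<le> w" by simp
        have "f m * schur (l m) x = (if x = m then f x else 0)" if "m \<in> A" for m
          using schur_highest[of "l m" n] schur_eq_0[of "l m" n x] l[OF that] that le
          by (auto simp: A_def)
        then have "(\<Sum>m\<in>A. f m * schur (l m) x) = (if x \<in> A then f x else 0)"
          using A(1) by (simp add: sum.delta')
        also have "\<dots> = f x" using x w le by (force simp: A_def)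
        finally show False using gx by (simp add: g_def)
      qed
    qed (use Suc.hyps(2) g in auto)
    moreover have "specialize f k y =
        specialize g k y + (\<Sum>m\<in>A. of_int (f m) * specialize (schur (l m)) k y)"
    proof -
      have "(\<Sum>m\<in>A. of_int (f m) * specialize (schur (l m)) k y) =
          (\<Sum>m\<in>A. of_int (f m) * (\<Sum>x\<in>monomials k n. of_int (schur (l m) x) * (\<Prod>i\<in>#x. y i)))"
        by (intro sum.cong refl) (simp add: specialize_eq_sum[OF schur])
      also have "\<dots> = (\<Sum>m\<in>A. \<Sum>x\<in>monomials k n. of_int (f m * schur (l m) x) * (\<Prod>i\<in>#x. y i))"
        by (simp add: sum_distrib_left mult.assoc)
      also have "\<dots> = (\<Sum>x\<in>monomials k n. \<Sum>m\<in>A. of_int (f m * schur (l m) x) * (\<Prod>i\<in>#x. y i))"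
        by (rule sum.swap)
      also have "\<dots> = (\<Sum>x\<in>monomials k n. of_int (\<Sum>m\<in>A. f m * schur (l m) x) * (\<Prod>i\<in>#x. y i))"
        by (simp add: sum_distrib_right)
      finally show ?thesis
        unfolding specialize_eq_sum[OF f] specialize_eq_sum[OF g]
        by (simp add: g_def sum.distrib[symmetric] left_diff_distrib)
    qed
    moreover have "D dvd (\<Sum>m\<in>A. of_int (f m) * specialize (schur (l m)) k y)"
      using D l by (intro dvd_sum dvd_mult) blast
    ultimately show ?case by simp
  qed
  from this[of f 0] show ?thesis using f by simp
qed

text \<open>
  A finite family of monomials that is stable under adjacent transpositions sums to a symmetric
  form. The involution \<open>s i\<close> on the index set \<open>X\<close> has to realize the transposition, so that
  monomials that occur several times are respected with their multiplicity.
\<close>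

lemma symmetric_form_card:
  assumes X: "finite X" "\<And>x. x \<in> X \<Longrightarrow> \<phi> x \<in> monomials k n"
    and s: "\<And>i x. Suc i < k \<Longrightarrow> x \<in> X \<Longrightarrow>
      s i x \<in> X \<and> s i (s i x) = x \<and> \<phi> (s i x) = image_mset (swap i) (\<phi> x)"
  shows "symmetric_form k n (\<lambda>m. int (card {x \<in> X. \<phi> x = m}))"
    and "specialize (\<lambda>m. int (card {x \<in> X. \<phi> x = m})) k y = (\<Sum>x\<in>X. \<Prod>i\<in>#\<phi> x. y i)"
proof -
  show sym: "symmetric_form k n (\<lambda>m. int (card {x \<in> X. \<phi> x = m}))"
    unfolding symmetric_form_def
  proof (intro conjI allI impI)
    fix m assume "int (card {x \<in> X. \<phi> x = m}) \<noteq> 0"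
    then have "{x \<in> X. \<phi> x = m} \<noteq> {}" by (auto simp del: Collect_empty_eq)
    then show "size m = n" using X(2) by (auto simp: monomials_def)
  next
    fix m :: "nat multiset" and i assume i: "Suc i < k"
    have "bij_betw (s i) {x \<in> X. \<phi> x = image_mset (swap i) m} {x \<in> X. \<phi> x = m}"
      by (rule bij_betw_byWitness[where f' = "s i"]) (use s[OF i] in auto)
    then show "int (card {x \<in> X. \<phi> x = image_mset (swap i) m}) = int (card {x \<in> X. \<phi> x = m})"
      by (simp add: bij_betw_same_card)
  qed
  have "(\<Sum>x\<in>X. \<Prod>i\<in>#\<phi> x. y i) = (\<Sum>m\<in>monomials k n. \<Sum>x | x \<in> X \<and> \<phi> x = m. \<Prod>i\<in>#\<phi> x. y i)"
    using X by (intro sum.group[symmetric] finite_monomials) auto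
  also have "\<dots> = (\<Sum>m\<in>monomials k n. of_int (int (card {x \<in> X. \<phi> x = m})) * (\<Prod>i\<in>#m. y i))"
    by (intro sum.cong refl) simp
  finally show "specialize (\<lambda>m. int (card {x \<in> X. \<phi> x = m})) k y = (\<Sum>x\<in>X. \<Prod>i\<in>#\<phi> x. y i)"
    by (simp add: specialize_eq_sum[OF sym])
qed


section \<open>Divisors of all symmetric forms at a geometric progression\<close>

lemma specialize_swap:
  assumes f: "symmetric_form k n f" and i: "Suc i < k"
  shows "specialize f k (\<lambda>j. y (swap i j)) = specialize f k y"
  unfolding specialize_eq_sum[OF f]
proof (rule sum.reindex_bij_witness[where i = "image_mset (swap i)" and j = "image_mset (swap i)"])
  fix m assume "m \<in> monomials k n"
  then have m: "set_mset m \<subseteq> {1..k}" "size m = n" by (auto simp: monomials_def)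
  show "image_mset (swap i) m \<in> monomials k n" "image_mset (swap i) m \<in> monomials k n"
    using swap_subset[OF m(1) i] m(2) by (auto simp: monomials_def)
  show "of_int (f (image_mset (swap i) m)) * (\<Prod>j\<in>#image_mset (swap i) m. y j) =
      of_int (f m) * (\<Prod>j\<in>#m. y (swap i j))"
    by (simp add: symmetric_form_swap[OF f m(1) i] image_mset.compositionality o_def)
qed simp_all

lemma specialize_cong:
  assumes f: "symmetric_form k n f" and y: "\<And>i. i \<in> {1..k} \<Longrightarrow> y i = z i"
  shows "specialize f k y = specialize f k z"
proof -
  have "(\<Prod>i\<in>#m. y i) = (\<Prod>i\<in>#m. z i)" if "m \<in> monomials k n" for m
  proof -
    have "image_mset y m = image_mset z m"
      using that y by (intro image_mset_cong) (auto simp: monomials_def)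
    then show ?thesis by simp
  qed
  then show ?thesis by (simp add: specialize_eq_sum[OF f])
qed

text \<open>
  Cyclic invariance, obtained by writing the cycle as a product of adjacent transpositions.
\<close>

lemma specialize_rotate:
  assumes f: "symmetric_form k n f"
  shows "specialize f k (\<lambda>i. y (if i < k then Suc i else 1)) = specialize f k y"
proof -
  \<comment> \<open>The cycle \<open>1 \<mapsto> 2 \<mapsto> \<dots> \<mapsto> j + 1 \<mapsto> 1\<close>.\<close>
  define rot where "rot j i = (if 1 \<le> i \<and> i \<le> j then Suc i else if i = Suc j then 1 else i)"
    for j i :: nat
  have "specialize f k (\<lambda>i. y (rot j i)) = specialize f k y" if "j < k" for j
    using that
  proof (induction j)
    case 0
    have "rot 0 i = i" for i by (auto simp: rot_def)
    then show ?case by simp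
  next
    case (Suc j)
    have "rot (Suc j) i = rot j (swap j i)" for i
      by (auto simp: rot_def transpose_def)
    then have "specialize f k (\<lambda>i. y (rot (Suc j) i)) = specialize f k (\<lambda>i. y (rot j i))"
      using specialize_swap[OF f Suc.prems, of "\<lambda>i. y (rot j i)"] by simp
    with Suc show ?case by simp
  qed
  note rotated = this[of "k - 1"]
  show ?thesis
  proof (cases "k = 0")
    case True
    then show ?thesis by (intro specialize_cong[OF f]) simp
  next
    case False
    have "specialize f k (\<lambda>i. y (if i < k then Suc i else 1)) = specialize f k (\<lambda>i. y (rot (k - 1) i))"
      using False by (intro specialize_cong[OF f]) (auto simp: rot_def)
    with rotated False show ?thesis by simp
  qed
qed

lemma specialize_scale:
  assumes f: "symmetric_form k n f"
  shows "specialize f k (\<lambda>i. c * y i) = c ^ n * specialize f k y"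
proof -
  have "(\<Prod>i\<in>#m. c * y i) = c ^ size m * (\<Prod>i\<in>#m. y i)" for m
    by (induction m) (auto simp: algebra_simps)
  then show ?thesis
    by (simp add: specialize_eq_sum[OF f] sum_distrib_left monomials_def mult.left_commute)
qed

lemma dvd_specialize_diff:
  fixes y z :: "nat \<Rightarrow> 'a :: comm_ring_1"
  assumes f: "symmetric_form k n f" and d: "\<And>i. i \<in> {1..k} \<Longrightarrow> d dvd y i - z i"
  shows "d dvd specialize f k y - specialize f k z"
proof -
  have "set_mset m \<subseteq> {1..k} \<Longrightarrow> d dvd (\<Prod>i\<in>#m. y i) - (\<Prod>i\<in>#m. z i)" for m
  proof (induction m)
    case (add x m)
    have "(\<Prod>i\<in>#add_mset x m. y i) - (\<Prod>i\<in>#add_mset x m. z i) =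
        y x * ((\<Prod>i\<in>#m. y i) - (\<Prod>i\<in>#m. z i)) + (y x - z x) * (\<Prod>i\<in>#m. z i)"
      by (simp add: algebra_simps)
    with add d[of x] show ?case by simp
  qed simp
  then show ?thesis
    unfolding specialize_eq_sum[OF f] sum_subtractf[symmetric] right_diff_distrib[symmetric]
    by (intro dvd_sum dvd_mult) (simp add: monomials_def)
qed

lemma one_minus_power_dvd:
  fixes q :: "'a :: comm_ring_1"
  shows "1 - q ^ a dvd 1 - q ^ (a * b)"
  by (metis dvd_triv_left one_diff_power_eq power_mult)

text \<open>
  Multiplying all the points \<open>1, q, \<dots>, q ^ (k - 1)\<close> by \<open>q\<close> permutes them cyclically modulo \<open>1 - q ^ k\<close>.
  A form \<open>S\<close> that is symmetric and homogeneous of degree \<open>n\<close> therefore satisfies \<open>q ^ n * S = S\<close>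
  modulo \<open>1 - q ^ k\<close>. A Bezout relation between \<open>n\<close> and \<open>k\<close> brings the exponent \<open>n\<close> down to the
  greatest common divisor.
\<close>

lemma one_minus_power_dvd_specialize:
  fixes q :: "'a :: comm_ring_1"
  assumes f: "symmetric_form k n f" and "n > 0"
  shows "1 - q ^ k dvd (1 - q ^ gcd n k) * specialize f k (\<lambda>i. q ^ (i - 1))" (is "_ dvd _ * ?S")
proof -
  have "specialize f k (\<lambda>i. q ^ ((if i < k then Suc i else 1) - 1)) = ?S"
    by (rule specialize_rotate[OF f, of "\<lambda>i. q ^ (i - 1)"])
  moreover have "1 - q ^ k dvd specialize f k (\<lambda>i. q ^ ((if i < k then Suc i else 1) - 1)) -
      specialize f k (\<lambda>i. q * q ^ (i - 1))"
  proof (rule dvd_specialize_diff[OF f])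
    fix i assume "i \<in> {1..k}"
    then show "1 - q ^ k dvd q ^ ((if i < k then Suc i else 1) - 1) - q * q ^ (i - 1)"
      by (cases "i < k") (auto simp: power_eq_if)
  qed
  ultimately have n: "1 - q ^ k dvd (1 - q ^ n) * ?S"
    by (simp add: specialize_scale[OF f] left_diff_distrib)
  obtain x y where xy: "n * x = k * y + gcd n k"
    using bezout_nat[of n k] \<open>n > 0\<close> by auto
  have "1 - q ^ k dvd (1 - q ^ (n * x)) * ?S"
    using n one_minus_power_dvd[of q n x] by (meson dvd_trans mult_dvd_mono dvd_refl)
  moreover have "1 - q ^ k dvd q ^ gcd n k * (1 - q ^ (k * y)) * ?S"
    using one_minus_power_dvd[of q k y] by simp
  moreover have "(1 - q ^ gcd n k) * ?S = (1 - q ^ (n * x)) * ?S - q ^ gcd n k * (1 - q ^ (k * y)) * ?S"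
    by (simp add: xy power_add algebra_simps)
  ultimately show ?thesis by simp
qed

lemma q_int_monic:
  assumes "a > 0"
  shows "lead_coeff (q_int a) = 1"
proof -
  have "lead_coeff (1 - [:0, 1 :: rat:] ^ b) = -1" if "b > 0" for b
  proof -
    have "degree (1 :: rat poly) < degree (- ([:0, 1 :: rat:] ^ b))"
      using that by (simp add: degree_power_eq)
    from lead_coeff_add_le[OF this] show ?thesis by (simp add: lead_coeff_power)
  qed
  from this[OF assms] this[of 1] show ?thesis
    using arg_cong[OF q_int_mult[of a], of lead_coeff] by (simp add: lead_coeff_mult)
qed

lemma q_int_div_dvd_specialize:
  assumes f: "symmetric_form k n f" and "n > 0"
  shows "q_int k div q_int (gcd n k) dvd specialize f k (\<lambda>i. [:0, 1 :: rat:] ^ (i - 1))"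
    (is "_ dvd ?S")
proof -
  have nz: "1 - [:0, 1 :: rat:] \<noteq> 0" by (simp add: one_pCons)
  have "q_int k * (1 - [:0, 1:]) dvd q_int (gcd n k) * ?S * (1 - [:0, 1:])"
    using one_minus_power_dvd_specialize[OF assms, of "[:0, 1 :: rat:]"]
    by (simp only: q_int_mult[symmetric] mult_ac)
  then have "q_int k dvd q_int (gcd n k) * ?S"
    using nz by (simp only: dvd_mult_cancel_right) simp
  moreover have "q_int (gcd n k) dvd q_int k" by (rule q_int_dvd) simp
  ultimately show ?thesis
    using q_int_monic[of "gcd n k"] \<open>n > 0\<close> by (auto simp: dvd_def)
qed

lemma poly_specialize:
  assumes f: "symmetric_form k n f"
  shows "poly (specialize f k y) x = specialize f k (\<lambda>i. poly (y i) x)"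
proof -
  have "poly (\<Prod>i\<in>#m. y i) x = (\<Prod>i\<in>#m. poly (y i) x)" for m
    by (induction m) auto
  then show ?thesis by (simp add: specialize_eq_sum[OF f] poly_sum)
qed

text \<open>
  The congruence holds already in \<open>\<int>[q]\<close>. After cancelling \<open>1 - q\<close>, it can be evaluated at \<open>q = 1\<close>, where
  the sum of the first \<open>a\<close> powers of \<open>q\<close> becomes \<open>a\<close>.
\<close>

lemma div_gcd_dvd_specialize:
  assumes f: "symmetric_form k n f" and "n > 0"
  shows "int k div gcd (int n) (int k) dvd specialize f k (\<lambda>i. 1)" (is "_ dvd ?S")
proof -
  let ?q = "[:0, 1 :: int:]"
  have nz: "1 - ?q \<noteq> 0" by (simp add: one_pCons)
  have "(1 - ?q) * (\<Sum>i<k. ?q ^ i) dvd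
      (1 - ?q) * ((\<Sum>i<gcd n k. ?q ^ i) * specialize f k (\<lambda>i. ?q ^ (i - 1)))"
    using one_minus_power_dvd_specialize[OF assms, of ?q]
    by (simp only: one_diff_power_eq mult.assoc)
  then have "(\<Sum>i<k. ?q ^ i) dvd (\<Sum>i<gcd n k. ?q ^ i) * specialize f k (\<lambda>i. ?q ^ (i - 1))"
    using nz by (simp only: dvd_mult_cancel_left) simp
  then obtain r where "(\<Sum>i<gcd n k. ?q ^ i) * specialize f k (\<lambda>i. ?q ^ (i - 1)) = (\<Sum>i<k. ?q ^ i) * r"
    by (elim dvdE)
  then have "poly ((\<Sum>i<gcd n k. ?q ^ i) * specialize f k (\<lambda>i. ?q ^ (i - 1))) 1 =
      poly ((\<Sum>i<k. ?q ^ i) * r) 1"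
    by (rule arg_cong)
  then have "int (gcd n k) * ?S = int k * poly r 1"
    by (simp add: poly_specialize[OF f] poly_sum poly_power)
  moreover have "int k = int (gcd n k) * (int k div int (gcd n k))" by simp
  ultimately have "int (gcd n k) * ?S = int (gcd n k) * (int k div int (gcd n k) * poly r 1)"
    by (metis mult.assoc)
  then have "?S = int k div int (gcd n k) * poly r 1"
    using \<open>n > 0\<close> by (simp only: mult_cancel_left) simp
  then show ?thesis by simp
qed


section \<open>Two families of symmetric forms\<close>

text \<open>
  The monomial symmetric function of the partition with \<open>d\<close> parts equal to \<open>c\<close>. For \<open>d = 1\<close> it is a
  power sum, and at \<open>y = 1\<close> it is a binomial coefficient.
\<close>

lemma dvd_sum_subset_powers:
  fixes D :: "'a :: comm_ring_1"
  assumes D: "\<And>l. l \<in> partitions_of (d * c) \<Longrightarrow> D dvd specialize (schur l) k y"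
  shows "D dvd (\<Sum>A | A \<subseteq> {1..k} \<and> card A = d. \<Prod>i\<in>A. y i ^ c)"
proof -
  let ?X = "{A. A \<subseteq> {1..k} \<and> card A = d}"
  define \<phi> :: "nat set \<Rightarrow> nat multiset" where "\<phi> A = repeat_mset c (mset_set A)" for A
  have X: "finite ?X" by (rule finite_subset[of _ "Pow {1..k}"]) auto
  have finA: "finite A" if "A \<in> ?X" for A using that finite_subset[of A "{1..k}"] by auto
  have mono: "\<phi> A \<in> monomials k (d * c)" if "A \<in> ?X" for A
  proof -
    have "set_mset (repeat_mset c M) \<subseteq> set_mset M" for M :: "nat multiset"
      by (induction c) auto
    from this[of "mset_set A"] show ?thesis
      using that finA[OF that] by (auto simp: \<phi>_def monomials_def)
  qed
  have image: "swap i ` A \<in> ?X \<and> swap i ` (swap i ` A) = A \<and> \<phi> (swap i ` A) = image_mset (swap i) (\<phi> A)"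
    if i: "Suc i < k" and A: "A \<in> ?X" for i A
  proof -
    have "swap i ` A \<subseteq> {1..k}"
      using A i by (auto simp: transpose_def)
    moreover have "card (swap i ` A) = card A" by (rule card_image) simp
    moreover have "image_mset (swap i) (repeat_mset c M) = repeat_mset c (image_mset (swap i) M)" for M
      by (induction c) auto
    moreover have "mset_set (swap i ` A) = image_mset (swap i) (mset_set A)"
      by (rule image_mset_mset_set[symmetric]) simp
    ultimately show ?thesis
      using A by (auto simp: \<phi>_def image_comp)
  qed
  have "(\<Prod>i\<in>#repeat_mset c M. y i) = (\<Prod>i\<in>#M. y i) ^ c" for M
    by (induction c) auto
  then have prod: "(\<Prod>i\<in>#\<phi> A. y i) = (\<Prod>i\<in>A. y i ^ c)" for A
    by (simp add: \<phi>_def prod_unfold_prod_mset[symmetric] prod_power_distrib)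
  from dvd_specialize_symmetric_form[OF D symmetric_form_card(1)[OF X mono image]]
  show ?thesis
    by (simp only: symmetric_form_card(2)[OF X mono image] prod)
qed

lemma sum_words:
  fixes y :: "'b \<Rightarrow> 'a :: comm_ring_1"
  assumes "finite A"
  shows "(\<Sum>w | set w \<subseteq> A \<and> length w = n. \<Prod>i\<in>#mset w. y i) = (\<Sum>i\<in>A. y i) ^ n"
proof (induction n)
  case 0
  have "{w. set w \<subseteq> A \<and> length w = 0} = {[]}" by auto
  then show ?case by simp
next
  case (Suc n)
  let ?W = "\<lambda>n. {w. set w \<subseteq> A \<and> length w = n}"
  have "bij_betw (\<lambda>(x, w). x # w) (A \<times> ?W n) (?W (Suc n))"
    by (rule bij_betw_byWitness[where f' = "\<lambda>w. (hd w, tl w)"]) (auto simp: length_Suc_conv)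
  then have "(\<Sum>w\<in>?W (Suc n). \<Prod>i\<in>#mset w. y i) = (\<Sum>(x, w)\<in>A \<times> ?W n. y x * (\<Prod>i\<in>#mset w. y i))"
    by (subst sum.reindex_bij_betw[symmetric]) (auto simp: case_prod_unfold)
  also have "\<dots> = (\<Sum>x\<in>A. y x) * (\<Sum>w\<in>?W n. \<Prod>i\<in>#mset w. y i)"
    by (simp add: sum_product sum.cartesian_product)
  finally show ?case using Suc by simp
qed

text \<open>
  The power of the first elementary symmetric polynomial is the sum over all words of length \<open>n\<close>.
\<close>

lemma dvd_sum_power:
  fixes D :: "'a :: comm_ring_1"
  assumes D: "\<And>l. l \<in> partitions_of n \<Longrightarrow> D dvd specialize (schur l) k y"
  shows "D dvd (\<Sum>i\<in>{1..k}. y i) ^ n"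
proof -
  let ?X = "{w. set w \<subseteq> {1..k} \<and> length w = n}"
  have X: "finite ?X" by (intro finite_lists_length_eq) simp
  have mono: "mset w \<in> monomials k n" if "w \<in> ?X" for w
    using that by (auto simp: monomials_def)
  have image: "map (swap i) w \<in> ?X \<and> map (swap i) (map (swap i) w) = w \<and>
      mset (map (swap i) w) = image_mset (swap i) (mset w)" if "Suc i < k" "w \<in> ?X" for i w
  proof -
    have "set (map (swap i) w) \<subseteq> {1..k}"
      using that by (auto simp: transpose_def)
    with that show ?thesis by simp
  qed
  show ?thesis
    using dvd_specialize_symmetric_form[OF D symmetric_form_card(1)[OF X mono image]]
    by (simp only: symmetric_form_card(2)[OF X mono image] sum_words[OF finite_atLeastAtMost])
qed

section \<open>Common divisors of the principal specializations\<close>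

text \<open>
  The cofactor of \<open>gcd D a\<close> in \<open>D\<close> is coprime to \<open>a\<close>, since a common factor would divide \<open>D\<close> twice.
\<close>

lemma squarefree_dvd_power_imp_dvd:
  fixes D :: "'a :: semiring_gcd"
  assumes D: "squarefree D" "D dvd a ^ n"
  shows "D dvd a"
proof -
  obtain E where E: "D = gcd D a * E" by (meson dvd_def gcd_dvd1)
  have "is_unit x" if x: "x dvd E" "x dvd a" for x
  proof -
    have "x dvd D" using x(1) E by (metis dvd_mult)
    with x have "x * x dvd D" by (subst E) (intro mult_dvd_mono gcd_greatest)
    then show ?thesis using D(1) by (simp add: squarefreeD power2_eq_square)
  qed
  then have "coprime E a" by (rule coprimeI)
  then have "coprime E (a ^ n)" by simp
  moreover have "E dvd a ^ n" using D(2) E by (metis dvd_mult_right)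
  ultimately have "is_unit E" by (meson coprime_common_divisor dvd_refl)
  then have "D dvd gcd D a" using E by (metis dvd_refl mult_unit_dvd_iff)
  then show ?thesis by simp
qed

text \<open>
  In characteristic \<open>0\<close>, the derivative of \<open>1 - X ^ N\<close> is a nonzero multiple of a power of \<open>X\<close>, which
  is coprime to \<open>1 - X ^ N\<close>.
\<close>

lemma squarefree_one_minus_X_power:
  assumes "N > 0"
  shows "squarefree (1 - [:0, 1 :: rat:] ^ N)"
proof (rule squarefreeI)
  fix P :: "rat poly" assume P: "P\<^sup>2 dvd 1 - [:0, 1:] ^ N"
  then obtain R where R: "1 - [:0, 1:] ^ N = P * (P * R)"
    by (auto simp: dvd_def power2_eq_square mult.assoc)
  have "pderiv (1 - [:0, 1 :: rat:] ^ N) = - smult (of_nat N) ([:0, 1:] ^ (N - 1))"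
    by (simp add: pderiv_diff pderiv_power pderiv_pCons)
  moreover have "P dvd pderiv (P * (P * R))"
    by (simp add: pderiv_mult)
  ultimately have "P dvd smult (of_nat N) ([:0, 1:] ^ (N - 1))"
    by (metis R dvd_minus_iff)
  then have "P dvd [:0, 1:] ^ (N - 1)"
    using assms by (simp add: dvd_smult_iff)
  then have "P dvd [:0, 1:] ^ N"
    using assms by (metis One_nat_def Suc_pred dvd_mult power_Suc)
  moreover have "P dvd 1 - [:0, 1:] ^ N" using R by simp
  ultimately have "P dvd (1 - [:0, 1:] ^ N) + [:0, 1:] ^ N" by (rule dvd_add[rotated])
  then show "is_unit P" by simp
qed

text \<open>
  A common divisor \<open>D\<close> divides the power sum \<open>(1 - q ^ (n * k)) / (1 - q ^ n)\<close>. As \<open>1 - q ^ (n * k)\<close> is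
  squarefree, \<open>D\<close> is squarefree and coprime to \<open>1 - q ^ n\<close>, hence to \<open>q_int (gcd n k)\<close>. It also divides
  \<open>q_int k ^ n\<close>, so it divides \<open>q_int k\<close>, and the factor \<open>q_int (gcd n k)\<close> can be removed.
\<close>

lemma dvd_q_int_div:
  assumes k: "k > 0" and n: "n > 0"
    and D: "\<And>l. l \<in> partitions_of n \<Longrightarrow> D dvd specialize (schur l) k (\<lambda>i. [:0, 1 :: rat:] ^ (i - 1))"
  shows "D dvd q_int k div q_int (gcd n k)"
proof -
  let ?q = "[:0, 1 :: rat:]"
  have nz: "1 - ?q \<noteq> 0" by (simp add: one_pCons)
  have power_sum: "(1 - ?q ^ c) * (\<Sum>i\<in>{1..k}. (?q ^ (i - 1)) ^ c) = 1 - ?q ^ (c * k)" for c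
  proof -
    have "(\<Sum>i\<in>{1..k}. (?q ^ (i - 1)) ^ c) = (\<Sum>i<k. (?q ^ c) ^ i)"
      by (rule sum.reindex_bij_witness[of _ Suc "\<lambda>i. i - 1"]) (auto simp flip: power_mult simp: mult.commute)
    then show ?thesis by (simp only: power_mult one_diff_power_eq)
  qed
  have "(1 - ?q) * (\<Sum>i\<in>{1..k}. ?q ^ (i - 1)) = (1 - ?q) * q_int k"
    using power_sum[of 1] q_int_mult[of k] by (simp add: mult.commute)
  then have sum: "(\<Sum>i\<in>{1..k}. ?q ^ (i - 1)) = q_int k" using nz by simp
  have "D dvd (\<Sum>A | A \<subseteq> {1..k} \<and> card A = 1. \<Prod>i\<in>A. (?q ^ (i - 1)) ^ n)"
    using D by (intro dvd_sum_subset_powers) simp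
  also have "(\<Sum>A | A \<subseteq> {1..k} \<and> card A = 1. \<Prod>i\<in>A. (?q ^ (i - 1)) ^ n) =
      (\<Sum>i\<in>{1..k}. (?q ^ (i - 1)) ^ n)"
    by (rule sum.reindex_bij_witness[of _ "\<lambda>i. {i}" the_elem]) (auto simp: card_1_singleton_iff)
  finally obtain E where E: "(\<Sum>i\<in>{1..k}. (?q ^ (i - 1)) ^ n) = D * E" by (auto simp: dvd_def)
  have DE: "1 - ?q ^ (n * k) = D * (E * (1 - ?q ^ n))"
    using power_sum[of n] by (simp only: E mult_ac)
  have sqf: "squarefree (1 - ?q ^ (n * k))"
    using k n by (intro squarefree_one_minus_X_power) simp
  have "D dvd 1 - ?q ^ (n * k)" unfolding DE by simp
  then have "squarefree D" using sqf squarefree_mono by blast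
  moreover have "D dvd q_int k ^ n" using dvd_sum_power[OF D] by (simp only: sum)
  ultimately have "D dvd q_int k" by (rule squarefree_dvd_power_imp_dvd)
  moreover have "coprime D (q_int (gcd n k))"
  proof (rule coprimeI)
    fix x assume x: "x dvd D" "x dvd q_int (gcd n k)"
    have "q_int (gcd n k) dvd q_int n" by (rule q_int_dvd) simp
    with x(2) have "x dvd 1 - ?q ^ n" unfolding q_int_mult[symmetric] by (meson dvd_mult2 dvd_trans)
    with x(1) have "x\<^sup>2 dvd 1 - ?q ^ (n * k)"
      unfolding DE power2_eq_square by (intro mult_dvd_mono dvd_mult)
    then show "is_unit x" using sqf squarefreeD by blast
  qed
  moreover have "q_int k = (q_int k div q_int (gcd n k)) * q_int (gcd n k)"
    using q_int_dvd[of "gcd n k" k] by simp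
  ultimately show ?thesis by (metis coprime_dvd_mult_left_iff)
qed

section \<open>Common divisors of the numbers of tableaux\<close>

text \<open>
  For \<open>0 < j < p ^ c\<close> the prime \<open>p\<close> divides \<open>k choose j\<close>, because \<open>p ^ c\<close> divides
  \<open>j * (k choose j)\<close> but not \<open>j\<close>. By Pascal's rule, neighbouring entries of row \<open>k - 1\<close>
  are then negatives of each other modulo \<open>p\<close>, starting from \<open>1\<close>.
\<close>

lemma prime_not_dvd_binomial_pred:
  fixes p :: nat
  assumes p: "prime p" and k: "k > 0" "p ^ c dvd k"
  shows "j < p ^ c \<Longrightarrow> \<not> p dvd (k - 1) choose j"
proof (induction j)
  case 0
  then show ?case using p by (simp add: prime_nat_iff)
next
  case (Suc j)
  have "p dvd k choose Suc j"
  proof (rule ccontr)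
    assume "\<not> p dvd k choose Suc j"
    then have "coprime (p ^ c) (k choose Suc j)" using p by (simp add: prime_imp_coprime)
    moreover have "Suc j * (k choose Suc j) = k * ((k - 1) choose j)"
      using Suc_times_binomial_eq[of "k - 1" j] k(1) by (simp add: mult.commute)
    then have "p ^ c dvd Suc j * (k choose Suc j)" using k(2) by simp
    ultimately have "p ^ c dvd Suc j" by (simp only: coprime_dvd_mult_left_iff)
    then show False using Suc.prems by (meson dvd_imp_le not_le zero_less_Suc)
  qed
  moreover have "k choose Suc j = ((k - 1) choose j) + ((k - 1) choose Suc j)"
    using k(1) by (cases k) auto
  ultimately show ?case using Suc by (metis Suc_lessD dvd_add_left_iff)
qed

text \<open>
  For each prime \<open>p\<close>, the largest power \<open>p ^ c\<close> of \<open>p\<close> that divides \<open>n\<close> and \<open>k\<close> gives a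
  binomial coefficient \<open>k choose p ^ c\<close> in which \<open>p\<close> occurs exactly as often as in \<open>k div gcd n k\<close>.
\<close>

lemma dvd_div_gcd_of_dvd_binomials:
  fixes D k n :: nat
  assumes k: "k > 0" and n: "n > 0" and D: "\<And>d. d dvd n \<Longrightarrow> D dvd k choose d"
  shows "D dvd k div gcd n k"
proof -
  let ?g = "gcd n k"
  have kg: "k div ?g * ?g = k" by simp
  have pos: "?g > 0" "k div ?g > 0" using k kg by (auto simp: div_greater_zero_iff intro: dvd_imp_le)
  have "D \<noteq> 0" using D[of 1] k by auto
  moreover have "multiplicity p D \<le> multiplicity p (k div ?g)" if p: "prime p" for p
  proof -
    define c where "c = min (multiplicity p k) (multiplicity p n)"
    have pk: "p ^ c dvd k" and pn: "p ^ c dvd n"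
      by (simp_all add: c_def multiplicity_dvd')
    have "p ^ c > 0" using p by (simp add: prime_gt_0_nat)
    then have eq: "p ^ c * (k choose p ^ c) = k * ((k - 1) choose (p ^ c - 1))"
      using Suc_times_binomial_eq[of "k - 1" "p ^ c - 1"] k by (simp add: mult.commute)
    have nd: "\<not> p dvd (k - 1) choose (p ^ c - 1)"
      using prime_not_dvd_binomial_pred[OF p k pk] \<open>p ^ c > 0\<close> by simp
    have nz2: "(k - 1) choose (p ^ c - 1) \<noteq> 0"
      using nd by (metis dvd_0_right)
    then have "k choose p ^ c \<noteq> 0"
      using eq k by (metis mult_is_0 not_gr_zero)
    note nz = this nz2
    have pe: "prime_elem p" using p by simp
    have "multiplicity p (p ^ c * (k choose p ^ c)) = c + multiplicity p (k choose p ^ c)"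
      using nz p pe by (subst prime_elem_multiplicity_mult_distrib[OF pe]) auto
    moreover have "multiplicity p (k * ((k - 1) choose (p ^ c - 1))) = multiplicity p k"
      using nz k nd pe by (subst prime_elem_multiplicity_mult_distrib[OF pe]) (auto simp: not_dvd_imp_multiplicity_0)
    ultimately have 1: "c + multiplicity p (k choose p ^ c) = multiplicity p k" using eq by simp
    have 2: "multiplicity p D \<le> multiplicity p (k choose p ^ c)"
      using D[OF pn] nz by (intro dvd_imp_multiplicity_le)
    have "multiplicity p (k div ?g * ?g) = multiplicity p (k div ?g) + multiplicity p ?g"
      using pos pe by (subst prime_elem_multiplicity_mult_distrib[OF pe]) auto
    moreover have "multiplicity p ?g \<le> c"
      using k n by (auto simp: c_def intro: dvd_imp_multiplicity_le)
    ultimately show ?thesis using 1 2 kg by simp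
  qed
  ultimately show ?thesis using pos by (intro multiplicity_le_imp_dvd) auto
qed

text \<open>
  At \<open>y = 1\<close> the monomial symmetric function with \<open>d\<close> parts \<open>n / d\<close> counts the
  subsets of size \<open>d\<close>.
\<close>

lemma dvd_div_gcd:
  fixes D :: int
  assumes k: "k > 0" and n: "n > 0"
    and D: "\<And>l. l \<in> partitions_of n \<Longrightarrow> D dvd specialize (schur l) k (\<lambda>i. 1)"
  shows "D dvd int k div gcd (int n) (int k)"
proof -
  have "nat \<bar>D\<bar> dvd k choose d" if d: "d dvd n" for d
  proof -
    obtain c where "n = d * c" using d by blast
    with D have "D dvd (\<Sum>A | A \<subseteq> {1..k} \<and> card A = d. \<Prod>i\<in>A. 1 ^ c)"
      by (intro dvd_sum_subset_powers) simp
    then have "D dvd int (k choose d)"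
      using n_subsets[of "{1..k}" d] by simp
    then have "int (nat \<bar>D\<bar>) dvd int (k choose d)" by simp
    then show ?thesis by (simp only: int_dvd_int_iff)
  qed
  from dvd_div_gcd_of_dvd_binomials[OF k n this] have "int (nat \<bar>D\<bar>) dvd int (k div gcd n k)"
    by (simp only: int_dvd_int_iff)
  then show ?thesis by (simp add: zdiv_int)
qed

section \<open>The greatest common divisors\<close>

theorem theorem1p5:
  fixes k n :: nat
  assumes "k > 0" and "n > 0"
  shows "Gcd ((\<lambda>l. specialize (schur l) k (\<lambda>i. 1 :: int)) ` partitions_of n)
           = int k div gcd (int n) (int k)
       \<and> Gcd ((\<lambda>l. specialize (schur l) k (\<lambda>i. [:0, 1 :: rat:] ^ (i - 1))) ` partitions_of n)
           = q_int k div q_int (gcd n k)"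
proof
  have "int k div gcd (int n) (int k) \<ge> 0"
    by (simp add: pos_imp_zdiv_nonneg_iff assms)
  then show "Gcd ((\<lambda>l. specialize (schur l) k (\<lambda>i. 1 :: int)) ` partitions_of n)
      = int k div gcd (int n) (int k)"
    using div_gcd_dvd_specialize[OF symmetric_form_schur \<open>n > 0\<close>] dvd_div_gcd[OF assms]
    by (intro GcdI[symmetric]) auto
next
  let ?c = "q_int k div q_int (gcd n k)"
  have "?c * q_int (gcd n k) = q_int k" using q_int_dvd[of "gcd n k" k] by simp
  from arg_cong[OF this, of lead_coeff] have "lead_coeff ?c = 1"
    using assms by (simp add: lead_coeff_mult q_int_monic)
  then have "normalize ?c = ?c" by (simp add: normalize_poly_def pCons_one)
  then show "Gcd ((\<lambda>l. specialize (schur l) k (\<lambda>i. [:0, 1 :: rat:] ^ (i - 1))) ` partitions_of n) = ?c"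
    using q_int_div_dvd_specialize[OF symmetric_form_schur \<open>n > 0\<close>] dvd_q_int_div[OF assms]
    by (intro GcdI[symmetric]) auto
qed

end
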